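(* Let $u>0$. As $t\to\infty$ the following hold: (i) $\mathbb{P}(D>t+u)/\mathbb{P}(D>t)\to 1$ if $\mu(t)\to\infty$. Moreover, if $\liminf_{t\to\infty} M(t,t+\ell-\epsilon)>0$ for some $\epsilon>0$, then $\liminf_{t\to\infty}\mathbb{P}(D>t+u)/\mathbb{P}(D>t)>0$. (ii) Conversely, let $u\ge \ell$. Then $\mathbb{P}(D>t+u)/\mathbb{P}(D>t)\to 0$ if $\mu(t)\to 0$. Moreover, if $\limsup_{t\to\infty} M(t,t+\ell)<\infty$, then $\limsup_{t\to\infty}\mathbb{P}(D>t+u)/\mathbb{P}(D>t)<1$.
   Context: Let $\ell>0$ be fixed. $\mathcal N$ is an inhomogeneous Poisson point process on $(0,\infty)$ with rate function $\mu(t)$, i.e. with intensity measure $\mu(t)\,\mathrm{d}t$; write $M(a,b)=\int_a^b\mu(t)\,\mathrm{d}t$. It is assumed that $M(0,t)<\infty$ for every finite $t$ and that $\mu(t)>0$ for Lebesgue-almost all $t\ge 0$. Let $0<T_1<T_2<\cdots$ be the epochs (points) of $\mathcal N$, with $T_0=0$ by convention; if $\mathcal N$ has only finitely many points, say $n$ of them, then $T_{n+1}=\infty$. Define $D=\min\{T_n:\ n\ge 0,\ T_{n+1}-T_n\ge \ell\}$, with $D=\infty$ if there is no such $n$. *)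

theory Defs
  imports "HOL-Probability.Probability"
begin

definition cum_rate :: "(real \<Rightarrow> real) \<Rightarrow> real \<Rightarrow> real \<Rightarrow> ennreal" where
  "cum_rate \<mu> a b = (\<integral>\<^sup>+t\<in>{a<..b}. ennreal (\<mu> t) \<partial>lborel)"

text \<open>
  A point process is a random locally finite set of points. Nothing is lost compared with
  counting measures: the intensity measure has no atoms, so the process is simple.
\<close>

definition num_points :: "('w \<Rightarrow> real set) \<Rightarrow> real set \<Rightarrow> 'w \<Rightarrow> nat" where
  "num_points N A \<omega> = card (N \<omega> \<inter> A)"

text \<open>
  The Poisson weights are written out because \<^const>\<open>poisson_pmf\<close> is only specified for a
  positive rate, while the mean \<open>m\<close> below may be zero. Bounded Borel sets suffice, and on
  them \<^const>\<open>card\<close> really counts the points, by local finiteness.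
\<close>

locale poisson_point_process = prob_space \<Omega> for \<Omega> :: "'w measure" +
  fixes \<mu> :: "real \<Rightarrow> real" and N :: "'w \<Rightarrow> real set"
  assumes points_pos: "\<omega> \<in> space \<Omega> \<Longrightarrow> N \<omega> \<subseteq> {0<..}"
    and locally_finite: "\<omega> \<in> space \<Omega> \<Longrightarrow> finite (N \<omega> \<inter> {0<..t})"
    and num_points_measurable:
      "\<lbrakk>A \<in> sets borel; bounded A; A \<subseteq> {0<..}\<rbrakk>
        \<Longrightarrow> num_points N A \<in> measurable \<Omega> (count_space UNIV)"
    and num_points_poisson:
      "\<lbrakk>A \<in> sets borel; bounded A; A \<subseteq> {0<..};
        0 \<le> m; (\<integral>\<^sup>+t\<in>A. ennreal (\<mu> t) \<partial>lborel) = ennreal m\<rbrakk>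
        \<Longrightarrow> \<P>(\<omega> in \<Omega>. num_points N A \<omega> = k) = m ^ k / fact k * exp (- m)"
    and num_points_indep:
      "\<lbrakk>finite I; disjoint_family_on B I;
        \<And>i. i \<in> I \<Longrightarrow> B i \<in> sets borel \<and> bounded (B i) \<and> B i \<subseteq> {0<..}\<rbrakk>
        \<Longrightarrow> indep_vars (\<lambda>_. count_space UNIV) (\<lambda>i. num_points N (B i)) (I :: nat set)"

text \<open>
  For a locally finite set \<open>S\<close> of positive reals, \<open>epoch S n\<close> is its \<open>n\<close>-th smallest point: the
  infimum is a minimum, or it is \<open>\<infinity>\<close> when no point is left.
\<close>

fun epoch :: "real set \<Rightarrow> nat \<Rightarrow> ereal" where
  "epoch S 0 = 0"
| "epoch S (Suc n) = Inf {ereal s |s. s \<in> S \<and> epoch S n < ereal s}"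

text \<open>
  The guard \<open>epoch S n < \<infinity>\<close> keeps only the indices of genuine epochs and avoids \<open>\<infinity> - \<infinity>\<close>.
  The epochs increase strictly as long as they are finite, so the infimum is attained at the least
  admissible \<open>n\<close>; it is \<open>\<infinity>\<close> if there is none.
\<close>

definition first_gap :: "real \<Rightarrow> real set \<Rightarrow> ereal" where
  "first_gap l S =
    Inf {epoch S n |n. epoch S n < \<infinity> \<and> ereal l \<le> epoch S (Suc n) - epoch S n}"

definition tail_ratio :: "'w measure \<Rightarrow> ('w \<Rightarrow> ereal) \<Rightarrow> real \<Rightarrow> real \<Rightarrow> real" where
  "tail_ratio \<Omega> D u t = \<P>(\<omega> in \<Omega>. ereal (t + u) < D \<omega>) / \<P>(\<omega> in \<Omega>. ereal t < D \<omega>)"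

end

theory Submission
  imports Defs
begin

text \<open>
  The event \<open>t < D\<close> says that every window \<open>(s, s + l)\<close> with \<open>0 \<le> s \<le> t\<close> contains a point
  (\<open>less_first_gap_iff_gapless\<close>). In this form it is increasing in the set of points, and it
  belongs to the \<open>\<sigma>\<close>-algebra generated by the events that some bounded set contains no point.
  These void events form a \<open>\<pi>\<close>-system, so the independence of the counts of disjoint sets passes
  to all events of this kind (\<open>prob_Int_void_if_disjoint\<close>). Let \<open>p t\<close> be the probability of
  \<open>t < D\<close>, and \<open>M\<close> the intensity measure. Two inequalities carry the result.

  Lower bound (\<open>prob_gapless_step_ge\<close>). If \<open>t < D\<close> and there is a point in \<open>(t + h, t + l]\<close>, then
  \<open>t + h < D\<close>. Both conditions are increasing, and conditioning on the void of
  \<open>(t + h, t + l]\<close> can only make \<open>t < D\<close> less likely (\<open>prob_gapless_and_void_le\<close>). Hence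
  \<open>p (t + h) \<ge> p t * (1 - exp (- M (t + h, t + l]))\<close>. After \<open>m\<close> such steps with \<open>m * h \<ge> u\<close>, a
  lower bound \<open>c\<close> on the masses keeps the tail ratio above \<open>(1 - exp (- c)) ^ m\<close>. If the rate
  tends to infinity, \<open>h = l / 2\<close> allows every \<open>c\<close>; under the assumption on the lower limit, \<open>h = \<epsilon>\<close>
  allows some positive \<open>c\<close>.

  Upper bound (\<open>prob_gapless_step_le\<close>). For \<open>u \<ge> l\<close>, surviving until \<open>t + u\<close> requires \<open>t < D\<close>,
  which depends only on the points up to \<open>t + l\<close>, and a point in \<open>(t + l, t + 2 * l]\<close>, which is
  independent of it. Hence the tail ratio is at most \<open>1 - exp (- M (t + l, t + 2 * l])\<close>.
\<close>

section \<open>The event that no long gap has started\<close>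

text \<open>
  The windows are open because a gap of length exactly \<open>l\<close> already stops the process.
\<close>
definition gapless :: "real \<Rightarrow> real set \<Rightarrow> real \<Rightarrow> bool" where
  "gapless l S t \<longleftrightarrow> (\<forall>s\<in>{0..t}. S \<inter> {s<..<s + l} \<noteq> {})"

lemma gapless_mono:
  assumes "gapless l S t" "S \<subseteq> S'" "t' \<le> t"
  shows "gapless l S' t'"
  unfolding gapless_def
proof
  fix s assume "s \<in> {0..t'}"
  then have "S \<inter> {s<..<s + l} \<noteq> {}" using assms unfolding gapless_def by auto
  then show "S' \<inter> {s<..<s + l} \<noteq> {}" using assms(2) by blast
qed

lemma locally_finite_has_least:
  fixes S X :: "real set"
  assumes pos: "S \<subseteq> {0<..}" and fin: "\<And>c. finite (S \<inter> {0<..c})"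
    and X: "X \<subseteq> insert 0 S" "X \<noteq> {}"
  obtains m where "m \<in> X" "\<And>x. x \<in> X \<Longrightarrow> m \<le> x"
proof -
  obtain x0 where x0: "x0 \<in> X" using X by blast
  have "X \<inter> {..x0} \<subseteq> insert 0 (S \<inter> {0<..x0})" using X pos by auto
  then have f: "finite (X \<inter> {..x0})" using fin by (meson finite_insert finite_subset)
  have ne: "X \<inter> {..x0} \<noteq> {}" using x0 by auto
  show ?thesis
  proof
    show "Min (X \<inter> {..x0}) \<in> X" using Min_in[OF f ne] by auto
    fix x assume x: "x \<in> X"
    show "Min (X \<inter> {..x0}) \<le> x"
    proof (cases "x \<le> x0")
      case True then show ?thesis using x f by (intro Min_le) auto
    next
      case False
      have "Min (X \<inter> {..x0}) \<le> x0" using Min_in[OF f ne] by auto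
      then show ?thesis using False by linarith
    qed
  qed
qed

lemma epoch_Suc_le: "x \<in> S \<Longrightarrow> epoch S n < ereal x \<Longrightarrow> epoch S (Suc n) \<le> ereal x"
  by (auto intro!: Inf_lower)

lemma epoch_strict_or_infinite:
  assumes pos: "S \<subseteq> {0<..}" and fin: "\<And>c. finite (S \<inter> {0<..c})"
  shows "epoch S (Suc n) = \<infinity> \<or> (\<exists>x\<in>S. epoch S (Suc n) = ereal x \<and> epoch S n < ereal x)"
proof (cases "{s \<in> S. epoch S n < ereal s} = {}")
  case True
  then have "{ereal s |s. s \<in> S \<and> epoch S n < ereal s} = {}" by blast
  then show ?thesis unfolding epoch.simps by (metis Inf_empty top_ereal_def)
next
  case False
  then obtain m where m: "m \<in> {s \<in> S. epoch S n < ereal s}"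
    "\<And>x. x \<in> {s \<in> S. epoch S n < ereal s} \<Longrightarrow> m \<le> x"
    using locally_finite_has_least[OF pos fin, of "{s \<in> S. epoch S n < ereal s}"] by blast
  have "epoch S (Suc n) = ereal m"
    unfolding epoch.simps using m by (intro antisym Inf_lower Inf_greatest) auto
  then show ?thesis using m by blast
qed

lemma epoch_finite_cases:
  assumes pos: "S \<subseteq> {0<..}" and fin: "\<And>c. finite (S \<inter> {0<..c})" and "epoch S n < \<infinity>"
  obtains e where "e \<in> insert 0 S" "0 \<le> e" "epoch S n = ereal e"
proof (cases n)
  case 0 then show ?thesis using that[of 0] by (simp add: zero_ereal_def)
next
  case (Suc k)
  then show ?thesis using epoch_strict_or_infinite[OF pos fin, of k] assms that by fastforce
qed

lemma epochs_unbounded: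
  assumes pos: "S \<subseteq> {0<..}" and fin: "\<And>c. finite (S \<inter> {0<..c})"
  shows "\<exists>n. ereal s < epoch S n"
proof (rule ccontr)
  assume "\<not> ?thesis"
  then have le: "epoch S n \<le> ereal s" for n by (meson not_le)
  have step: "\<exists>x\<in>S. epoch S (Suc n) = ereal x \<and> epoch S n < ereal x" for n
    using epoch_strict_or_infinite[OF pos fin, of n] le[of "Suc n"] by force
  have sm: "strict_mono (epoch S)"
    by (rule strict_mono_Suc_iff[THEN iffD2]) (metis step)
  have "range (\<lambda>n. epoch S (Suc n)) \<subseteq> ereal ` (S \<inter> {0<..s})"
  proof safe
    fix n
    obtain x where "x \<in> S" "epoch S (Suc n) = ereal x" using step by blast
    then show "epoch S (Suc n) \<in> ereal ` (S \<inter> {0<..s})" using le[of "Suc n"] pos by force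
  qed
  then have "finite (range (\<lambda>n. epoch S (Suc n)))" using fin by (meson finite_imageI finite_subset)
  moreover have "inj (\<lambda>n. epoch S (Suc n))"
    using strict_mono_eq[OF sm] by (auto intro!: injI simp del: epoch.simps)
  ultimately show False using finite_imageD by blast
qed

text \<open>
  If a window \<open>(s, s + l)\<close> with \<open>0 \<le> s \<le> t\<close> is void, the gap straddling it starts at an epoch
  not after \<open>s\<close> and is at least \<open>l\<close> long; conversely a gap starting at \<open>e \<le> t\<close> leaves the
  window of \<open>s = e\<close> void. Quantifying over all real windows instead of over the epochs makes
  the event visibly increasing in the set of points.
\<close>
lemma less_first_gap_iff_gapless:
  assumes pos: "S \<subseteq> {0<..}" and fin: "\<And>c. finite (S \<inter> {0<..c})"
  shows "ereal t < first_gap l S \<longleftrightarrow> gapless l S t"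
proof
  assume D: "ereal t < first_gap l S"
  show "gapless l S t" unfolding gapless_def
  proof (intro ballI notI)
    fix s assume s: "s \<in> {0..t}" and void: "S \<inter> {s<..<s + l} = {}"
    define n where "n = (LEAST n. ereal s < epoch S n)"
    have n: "ereal s < epoch S n"
      unfolding n_def using epochs_unbounded[OF pos fin] by (rule LeastI_ex)
    then have "n \<noteq> 0" using s by (auto intro!: gr0I)
    then obtain k where k: "n = Suc k" by (cases n) auto
    have ek: "epoch S k \<le> ereal s" using not_less_Least[of k "\<lambda>n. ereal s < epoch S n"] k n_def by auto
    then have "epoch S k < \<infinity>" by auto
    then obtain e where e: "epoch S k = ereal e" using epoch_finite_cases[OF pos fin] by metis
    have "ereal l \<le> epoch S (Suc k) - epoch S k"
      using epoch_strict_or_infinite[OF pos fin, of k]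
    proof
      assume "\<exists>x\<in>S. epoch S (Suc k) = ereal x \<and> epoch S k < ereal x"
      then obtain x where x: "x \<in> S" "epoch S (Suc k) = ereal x" by blast
      then have "s + l \<le> x" using n k void by force
      then show ?thesis using x e ek by auto
    qed (simp add: e del: epoch.simps)
    then have "first_gap l S \<le> epoch S k"
      unfolding first_gap_def using e
      by (intro Inf_lower CollectI exI[of _ k]) (simp del: epoch.simps)
    then show False using D ek s
      by (metis atLeastAtMost_iff ereal_less_eq(3) leD order.trans)
  qed
next
  assume g: "gapless l S t"
  define X where
    "X = {e. \<exists>n. epoch S n = ereal e \<and> ereal l \<le> epoch S (Suc n) - epoch S n}"
  have X: "{epoch S n |n. epoch S n < \<infinity> \<and> ereal l \<le> epoch S (Suc n) - epoch S n} = ereal ` X"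
  proof (intro set_eqI iffI)
    fix y assume "y \<in> {epoch S n |n. epoch S n < \<infinity> \<and> ereal l \<le> epoch S (Suc n) - epoch S n}"
    then obtain n where n: "y = epoch S n" "epoch S n < \<infinity>" "ereal l \<le> epoch S (Suc n) - epoch S n"
      by blast
    then obtain e where "epoch S n = ereal e" using epoch_finite_cases[OF pos fin] by metis
    then show "y \<in> ereal ` X" unfolding X_def using n by blast
  next
    fix y assume "y \<in> ereal ` X"
    then obtain e n where "y = ereal e" "epoch S n = ereal e"
      "ereal l \<le> epoch S (Suc n) - epoch S n" unfolding X_def by blast
    then show "y \<in> {epoch S n |n. epoch S n < \<infinity> \<and> ereal l \<le> epoch S (Suc n) - epoch S n}"
      by (intro CollectI exI[of _ n]) (simp del: epoch.simps)
  qed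
  have sub: "X \<subseteq> insert 0 S"
  proof
    fix e assume "e \<in> X"
    then obtain n where n: "epoch S n = ereal e" unfolding X_def by blast
    then obtain e' where "e' \<in> insert 0 S" "epoch S n = ereal e'"
      using epoch_finite_cases[OF pos fin, of n] by (metis ereal_less(4) less_ereal.simps(4))
    then show "e \<in> insert 0 S" using n by simp
  qed
  have gt: "t < e" if e: "e \<in> X" for e
  proof (rule ccontr)
    assume "\<not> t < e"
    then have "e \<in> {0..t}" using sub e pos by auto
    then obtain x where x: "x \<in> S" "e < x" "x < e + l" using g unfolding gapless_def by force
    obtain n where n: "epoch S n = ereal e" "ereal l \<le> epoch S (Suc n) - epoch S n"
      using e unfolding X_def by blast
    have "epoch S (Suc n) \<le> ereal x" using epoch_Suc_le[of x S n] x n by simp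
    then have "epoch S (Suc n) - ereal e \<le> ereal x - ereal e" by (intro ereal_minus_mono) auto
    then have "ereal l \<le> ereal (x - e)" using n by (metis order.trans ereal_minus(1))
    then show False using x by simp
  qed
  show "ereal t < first_gap l S"
  proof (cases "X = {}")
    case True
    then show ?thesis unfolding first_gap_def X by (simp add: top_ereal_def)
  next
    case False
    then obtain m where m: "m \<in> X" "\<And>x. x \<in> X \<Longrightarrow> m \<le> x"
      using locally_finite_has_least[OF pos fin sub] by blast
    have "ereal m \<le> Inf (ereal ` X)" using m by (auto intro!: Inf_greatest)
    moreover have "ereal t < ereal m" using gt[OF m(1)] by simp
    ultimately show ?thesis unfolding first_gap_def X by (rule less_le_trans[rotated])
  qed
qed

text \<open>
  The point of a window found for each \<open>s\<close> stays in nearby, slightly shortened windows, so by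
  compactness of \<open>[0, t]\<close> one shortening serves all \<open>s\<close>. With that slack, rational windows
  decide the event. The end point \<open>t\<close> is kept because no rational just above it is available.
\<close>
lemma gapless_iff_countable:
  assumes "0 \<le> t"
  shows "gapless l S t \<longleftrightarrow>
    (\<exists>n. \<forall>q\<in>insert t (\<rat> \<inter> {0..t}). S \<inter> {q<..<q + l - 1 / real (Suc n)} \<noteq> {})"
    (is "_ \<longleftrightarrow> ?R")
proof
  assume g: "gapless l S t"
  show ?R
  proof (rule ccontr)
    assume "\<not> ?R"
    then have "\<forall>n. \<exists>q\<in>insert t (\<rat> \<inter> {0..t}). S \<inter> {q<..<q + l - 1 / real (Suc n)} = {}" by blast
    moreover have "insert t (\<rat> \<inter> {0..t}) \<subseteq> {0..t}" using assms by auto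
    ultimately have "\<forall>n. \<exists>q. q \<in> {0..t} \<and> S \<inter> {q<..<q + l - 1 / real (Suc n)} = {}" by blast
    then obtain q where q: "\<And>n. q n \<in> {0..t}"
      "\<And>n. S \<inter> {q n<..<q n + l - 1 / real (Suc n)} = {}" by metis
    obtain s r where s: "s \<in> {0..t}" and r: "strict_mono r" and lim: "(q \<circ> r) \<longlonglongrightarrow> s"
      using compact_Icc[of 0 t] q(1) unfolding compact_def by blast
    obtain x where x: "x \<in> S" "s < x" "x < s + l" using g s unfolding gapless_def by force
    have "(\<lambda>n. q (r n) + l - 1 / real (Suc (r n))) \<longlonglongrightarrow> s + l - 0"
      using lim LIMSEQ_subseq_LIMSEQ[OF LIMSEQ_Suc[OF lim_1_over_n] r]
      by (intro tendsto_intros) (auto simp: o_def)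
    then have "\<forall>\<^sub>F n in sequentially. x < q (r n) + l - 1 / real (Suc (r n))"
      using x by (intro order_tendstoD(1)) auto
    moreover have "\<forall>\<^sub>F n in sequentially. q (r n) < x"
      using order_tendstoD(2)[OF lim x(2)] by (simp add: o_def)
    ultimately have "\<forall>\<^sub>F n in sequentially. False"
      by eventually_elim (use q(2) x in fastforce)
    then show False by simp
  qed
next
  assume ?R
  then obtain n where n: "\<forall>q\<in>insert t (\<rat> \<inter> {0..t}). S \<inter> {q<..<q + l - 1 / real (Suc n)} \<noteq> {}" ..
  show "gapless l S t" unfolding gapless_def
  proof
    fix s assume s: "s \<in> {0..t}"
    have "\<exists>q\<in>insert t (\<rat> \<inter> {0..t}). s \<le> q \<and> q \<le> s + 1 / real (Suc n)"
    proof (cases "s = t")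
      case False
      then have "s < min t (s + 1 / real (Suc n))" using s by auto
      then obtain q where "q \<in> \<rat>" "s < q" "q < min t (s + 1 / real (Suc n))"
        using Rats_dense_in_real by blast
      then show ?thesis using s by (intro bexI[of _ q]) auto
    qed auto
    then obtain q where q: "q\<in>insert t (\<rat> \<inter> {0..t})" "s \<le> q" "q \<le> s + 1 / real (Suc n)" by blast
    have "S \<inter> {q<..<q + l - 1 / real (Suc n)} \<noteq> {}" using n q(1) by blast
    then obtain x where "x \<in> S" "q < x" "x < q + l - 1 / real (Suc n)" by auto
    then have "x \<in> S \<inter> {s<..<s + l}" using q by auto
    then show "S \<inter> {s<..<s + l} \<noteq> {}" by blast
  qed
qed

section \<open>Void events\<close>

context poisson_point_process
begin

definition void :: "real set \<Rightarrow> 'w set" where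
  "void B = {\<omega> \<in> space \<Omega>. N \<omega> \<inter> B = {}}"

definition void_events :: "real set \<Rightarrow> 'w set set" where
  "void_events C = void ` {B. B \<in> sets borel \<and> bounded B \<and> B \<subseteq> {0<..} \<inter> C}"

lemma void_eq_num_points:
  assumes "bounded B" "B \<subseteq> {0<..}"
  shows "void B = {\<omega> \<in> space \<Omega>. num_points N B \<omega> = 0}"
proof -
  obtain c where c: "\<And>x. x \<in> B \<Longrightarrow> \<bar>x\<bar> \<le> c" using assms by (auto simp: bounded_real)
  have "finite (N \<omega> \<inter> B)" if "\<omega> \<in> space \<Omega>" for \<omega>
    by (rule finite_subset[OF _ locally_finite[OF that, of c]]) (use c assms in force)
  then show ?thesis unfolding void_def num_points_def by auto
qed

lemma void_measurable [measurable]: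
  assumes "B \<in> sets borel" "bounded B" "B \<subseteq> {0<..}"
  shows "void B \<in> events"
proof -
  have [measurable]: "num_points N B \<in> measurable \<Omega> (count_space UNIV)"
    using assms by (rule num_points_measurable)
  show ?thesis unfolding void_eq_num_points[OF assms(2,3)] by measurable
qed

lemma prob_void_interval:
  assumes "0 \<le> a" "cum_rate \<mu> a b < \<infinity>"
  shows "prob (void {a<..b}) = exp (- enn2real (cum_rate \<mu> a b))"
proof -
  have b: "bounded {a<..b}" "{a<..b} \<subseteq> {0<..}" using assms by auto
  have "(\<integral>\<^sup>+t\<in>{a<..b}. ennreal (\<mu> t) \<partial>lborel) = ennreal (enn2real (cum_rate \<mu> a b))"
    using assms(2) unfolding cum_rate_def[symmetric] by simp
  from num_points_poisson[OF _ b _ this, of 0]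
  show ?thesis unfolding void_eq_num_points[OF b] by simp
qed

lemma prob_void_Int:
  assumes "B \<in> sets borel" "bounded B" "B \<subseteq> {0<..}" "C \<in> sets borel" "bounded C" "C \<subseteq> {0<..}"
    and "B \<inter> C = {}"
  shows "prob (void B \<inter> void C) = prob (void B) * prob (void C)"
proof -
  define F where "F i = (if i = (0::nat) then B else C)" for i
  have "indep_vars (\<lambda>_. count_space UNIV) (\<lambda>i. num_points N (F i)) {0, 1}"
    using assms by (intro num_points_indep) (auto simp: F_def disjoint_family_on_def)
  from indep_varsD_finite[OF this, of "\<lambda>_. {0}"]
  have "prob (\<Inter>i\<in>{0, 1}. num_points N (F i) -` {0} \<inter> space \<Omega>) =
      (\<Prod>i\<in>{0, 1}. prob (num_points N (F i) -` {0} \<inter> space \<Omega>))" by simp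
  moreover have "num_points N A -` {0} \<inter> space \<Omega> = {\<omega> \<in> space \<Omega>. num_points N A \<omega> = 0}" for A
    by auto
  ultimately show ?thesis using assms by (simp add: F_def void_eq_num_points)
qed

text \<open>
  Void events of subsets of \<open>C\<close> form a \<open>\<pi>\<close>-system, since voids of two sets intersect to the void
  of the union. Hence independence of disjoint pairs already extends to the generated
  \<open>\<sigma>\<close>-algebra.
\<close>
lemma prob_Int_void_if_disjoint:
  assumes E: "E \<in> sigma_sets (space \<Omega>) (void_events C)"
    and J: "J \<in> sets borel" "bounded J" "J \<subseteq> {0<..}" and disj: "C \<inter> J = {}"
  shows "prob (E \<inter> void J) = prob E * prob (void J)"
proof -
  have "indep_set (void_events C) {void J}"
  proof (rule indep_setI)
    show "void_events C \<subseteq> events" by (auto simp: void_events_def intro!: void_measurable)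
    show "{void J} \<subseteq> events" using void_measurable[OF J] by simp
    fix a b assume "a \<in> void_events C" "b \<in> {void J}"
    then show "prob (a \<inter> b) = prob a * prob b"
      using J disj by (auto simp: void_events_def intro!: prob_void_Int)
  qed
  moreover have "Int_stable (void_events C)"
    unfolding Int_stable_def
  proof (intro ballI)
    fix a b assume "a \<in> void_events C" "b \<in> void_events C"
    then obtain A B where AB: "a = void A" "b = void B" "A \<in> sets borel" "B \<in> sets borel"
      "bounded A" "bounded B" "A \<subseteq> {0<..} \<inter> C" "B \<subseteq> {0<..} \<inter> C"
      unfolding void_events_def by blast
    then have "a \<inter> b = void (A \<union> B)" unfolding void_def by auto
    then show "a \<inter> b \<in> void_events C" using AB by (auto simp: void_events_def)
  qed
  moreover have "Int_stable {void J}" by (simp add: Int_stable_def)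
  ultimately have "indep_set (sigma_sets (space \<Omega>) (void_events C)) (sigma_sets (space \<Omega>) {void J})"
    by (rule indep_set_sigma_sets)
  then show ?thesis using E by (rule indep_setD) auto
qed

lemma gapless_in_void_sigma:
  assumes [measurable]: "C \<in> sets borel"
  shows "{\<omega> \<in> space \<Omega>. gapless l (N \<omega> \<inter> C) t} \<in> sigma_sets (space \<Omega>) (void_events C)"
proof (cases "0 \<le> t")
  case False
  then have "{\<omega> \<in> space \<Omega>. gapless l (N \<omega> \<inter> C) t} = space \<Omega>" by (auto simp: gapless_def)
  then show ?thesis by (simp add: sigma_sets_top)
next
  case True
  define \<Sigma> where "\<Sigma> = sigma (space \<Omega>) (void_events C)"
  have sub: "void_events C \<subseteq> Pow (space \<Omega>)" by (auto simp: void_events_def void_def)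
  have sets: "sets \<Sigma> = sigma_sets (space \<Omega>) (void_events C)" and space: "space \<Sigma> = space \<Omega>"
    unfolding \<Sigma>_def using sub by (auto simp: space_measure_of)
  have window: "{\<omega> \<in> space \<Sigma>. N \<omega> \<inter> C \<inter> {q<..<r} \<noteq> {}} \<in> sets \<Sigma>" if "0 \<le> q" for q r
  proof -
    have "void (C \<inter> {q<..<r}) \<in> void_events C"
      unfolding void_events_def using that by (intro imageI) (auto intro: bounded_subset[of "{q<..<r}"])
    then have "void (C \<inter> {q<..<r}) \<in> sets \<Sigma>" unfolding sets by (rule sigma_sets.Basic)
    then have "space \<Sigma> - void (C \<inter> {q<..<r}) \<in> sets \<Sigma>" by (rule sets.compl_sets)
    also have "space \<Sigma> - void (C \<inter> {q<..<r}) = {\<omega> \<in> space \<Sigma>. N \<omega> \<inter> C \<inter> {q<..<r} \<noteq> {}}"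
      unfolding void_def space by (auto simp: Int_assoc)
    finally show ?thesis .
  qed
  have "{\<omega> \<in> space \<Sigma>. \<exists>n. \<forall>q\<in>insert t (\<rat> \<inter> {0..t}).
      N \<omega> \<inter> C \<inter> {q<..<q + l - 1 / real (Suc n)} \<noteq> {}} \<in> sets \<Sigma>"
  proof (intro sets.sets_Collect_countable_Ex sets.sets_Collect_countable_All' window)
    show "countable (insert t (\<rat> \<inter> {0..t}))" by (simp add: countable_rat)
  qed (use True in auto)
  then show ?thesis unfolding gapless_iff_countable[OF True] sets space .
qed

lemma gapless_measurable: "{\<omega> \<in> space \<Omega>. gapless l (N \<omega>) t} \<in> events"
proof -
  have "void_events UNIV \<subseteq> events" by (auto simp: void_events_def intro!: void_measurable)
  then have "sigma_sets (space \<Omega>) (void_events UNIV) \<subseteq> events" by (rule sets.sigma_sets_subset)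
  then show ?thesis using gapless_in_void_sigma[of UNIV l t] by auto
qed

section \<open>One-step bounds\<close>

text \<open>
  A special case of the positive association of increasing events. Where \<open>J\<close> is void, deleting the
  points of \<open>J\<close> changes nothing, but after the deletion the event no longer depends on \<open>J\<close>;
  so the joint probability factors, and the deletion only makes the increasing event rarer.
\<close>
lemma prob_gapless_and_void_le:
  assumes J: "J \<in> sets borel" "bounded J" "J \<subseteq> {0<..}"
  shows "prob ({\<omega> \<in> space \<Omega>. gapless l (N \<omega>) t} \<inter> void J)
    \<le> prob {\<omega> \<in> space \<Omega>. gapless l (N \<omega>) t} * prob (void J)"
proof -
  let ?E = "{\<omega> \<in> space \<Omega>. gapless l (N \<omega> \<inter> (- J)) t}"
  have "N \<omega> \<inter> (- J) = N \<omega>" if "\<omega> \<in> void J" for \<omega> using that by (auto simp: void_def)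
  then have "{\<omega> \<in> space \<Omega>. gapless l (N \<omega>) t} \<inter> void J = ?E \<inter> void J" by auto
  then have "prob ({\<omega> \<in> space \<Omega>. gapless l (N \<omega>) t} \<inter> void J) = prob ?E * prob (void J)"
    using prob_Int_void_if_disjoint[OF gapless_in_void_sigma[of "- J"] J] J(1) by (simp add: borel_comp)
  also have "\<dots> \<le> prob {\<omega> \<in> space \<Omega>. gapless l (N \<omega>) t} * prob (void J)"
    by (intro mult_right_mono finite_measure_mono gapless_measurable)
      (auto intro: gapless_mono[OF _ Int_lower1 order_refl])
  finally show ?thesis .
qed

text \<open>
  A point in \<open>(t + h, t + l]\<close> lies in the window \<open>(s, s + l)\<close> of every \<open>s \<in> (t, t + h]\<close>, so it
  carries gaplessness from \<open>t\<close> to \<open>t + h\<close>.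
\<close>
lemma prob_gapless_step_ge:
  assumes "0 \<le> t + h" "0 \<le> h" "cum_rate \<mu> (t + h) (t + l) < \<infinity>"
  shows "prob {\<omega> \<in> space \<Omega>. gapless l (N \<omega>) t} * (1 - exp (- enn2real (cum_rate \<mu> (t + h) (t + l))))
    \<le> prob {\<omega> \<in> space \<Omega>. gapless l (N \<omega>) (t + h)}"
proof -
  let ?A = "\<lambda>t. {\<omega> \<in> space \<Omega>. gapless l (N \<omega>) t}" and ?J = "{t + h<..t + l}"
  have J: "?J \<in> sets borel" "bounded ?J" "?J \<subseteq> {0<..}" using assms(1,2) by (simp_all add: subset_iff)
  have "gapless l (N \<omega>) (t + h)" if g: "gapless l (N \<omega>) t" and x: "N \<omega> \<inter> ?J \<noteq> {}" for \<omega>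
    unfolding gapless_def
  proof
    fix s assume s: "s \<in> {0..t + h}"
    show "N \<omega> \<inter> {s<..<s + l} \<noteq> {}"
    proof (cases "s \<le> t")
      case True then show ?thesis using g s by (auto simp: gapless_def)
    next
      case False
      obtain y where "y \<in> N \<omega>" "y \<in> ?J" using x by blast
      then have "y \<in> N \<omega> \<inter> {s<..<s + l}" using False s by auto
      then show ?thesis by blast
    qed
  qed
  then have sub: "?A t - ?A t \<inter> void ?J \<subseteq> ?A (t + h)" by (auto simp: void_def)
  have "prob (?A t) * (1 - prob (void ?J)) \<le> prob (?A t) - prob (?A t \<inter> void ?J)"
    using prob_gapless_and_void_le[OF J, of l t] by (simp add: algebra_simps)
  also have "\<dots> = prob (?A t - ?A t \<inter> void ?J)"
    using gapless_measurable void_measurable[OF J] by (intro finite_measure_Diff[symmetric]) auto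
  also have "\<dots> \<le> prob (?A (t + h))" using sub gapless_measurable by (rule finite_measure_mono)
  finally show ?thesis using prob_void_interval[of "t + h" "t + l"] assms by simp
qed

text \<open>
  Gaplessness up to \<open>t\<close> is decided by the points before \<open>t + l\<close> and forces one in \<open>(t, t + l)\<close>. If
  independently \<open>(t + l, t + 2 * l]\<close> is void, the last point up to \<open>t + l\<close> starts a gap longer
  than \<open>l\<close>. In terms of windows, the one at \<open>s = t + l\<close> is void.
\<close>
lemma prob_gapless_step_le:
  assumes "0 \<le> t" "0 < l" "l \<le> u" "cum_rate \<mu> (t + l) (t + l + l) < \<infinity>"
  shows "prob {\<omega> \<in> space \<Omega>. gapless l (N \<omega>) (t + u)}
    \<le> prob {\<omega> \<in> space \<Omega>. gapless l (N \<omega>) t} * (1 - exp (- enn2real (cum_rate \<mu> (t + l) (t + l + l))))"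
proof -
  let ?A = "\<lambda>t. {\<omega> \<in> space \<Omega>. gapless l (N \<omega>) t}" and ?J = "{t + l<..t + l + l}"
  have J: "?J \<in> sets borel" "bounded ?J" "?J \<subseteq> {0<..}" using assms(1,2) by (simp_all add: subset_iff)
  have "gapless l (N \<omega>) t = gapless l (N \<omega> \<inter> {..t + l}) t" for \<omega>
  proof
    assume g: "gapless l (N \<omega>) t"
    have "N \<omega> \<inter> {..t + l} \<inter> {s<..<s + l} = N \<omega> \<inter> {s<..<s + l}" if "s \<in> {0..t}" for s
      using that by auto
    then show "gapless l (N \<omega> \<inter> {..t + l}) t" using g by (simp add: gapless_def)
  qed (rule gapless_mono[OF _ Int_lower1 order_refl])
  then have "?A t \<in> sigma_sets (space \<Omega>) (void_events {..t + l})"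
    using gapless_in_void_sigma[of "{..t + l}" l t] by simp
  then have fact: "prob (?A t \<inter> void ?J) = prob (?A t) * prob (void ?J)"
    using J by (rule prob_Int_void_if_disjoint) auto
  have "gapless l (N \<omega>) t \<and> \<omega> \<notin> void ?J" if "gapless l (N \<omega>) (t + u)" for \<omega>
  proof
    show "gapless l (N \<omega>) t" using assms by (intro gapless_mono[OF that]) auto
    have "t + l \<in> {0..t + u}" using assms by auto
    then have "N \<omega> \<inter> {t + l<..<t + l + l} \<noteq> {}" using that unfolding gapless_def by blast
    moreover have "{t + l<..<t + l + l} \<subseteq> ?J" by auto
    ultimately show "\<omega> \<notin> void ?J" unfolding void_def by blast
  qed
  then have "?A (t + u) \<subseteq> ?A t - ?A t \<inter> void ?J" by auto
  then have "prob (?A (t + u)) \<le> prob (?A t - ?A t \<inter> void ?J)"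
    using gapless_measurable void_measurable[OF J] by (intro finite_measure_mono) auto
  also have "\<dots> = prob (?A t) - prob (?A t \<inter> void ?J)"
    using gapless_measurable void_measurable[OF J] by (intro finite_measure_Diff) auto
  also have "\<dots> = prob (?A t) * (1 - prob (void ?J))" using fact by (simp add: algebra_simps)
  finally show ?thesis using prob_void_interval[of "t + l" "t + l + l"] assms by simp
qed

end

section \<open>Asymptotics of the tail ratio\<close>

lemma cum_rate_ge:
  assumes "0 \<le> K" "a \<le> b" "\<And>t. t \<in> {a<..b} \<Longrightarrow> K \<le> \<mu> t"
  shows "ennreal (K * (b - a)) \<le> cum_rate \<mu> a b"
proof -
  have "ennreal (K * (b - a)) = (\<integral>\<^sup>+t\<in>{a<..b}. ennreal K \<partial>lborel)"
    using assms by (simp add: nn_integral_cmult_indicator ennreal_mult[symmetric])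
  also have "\<dots> \<le> cum_rate \<mu> a b"
    unfolding cum_rate_def
    by (intro nn_integral_mono) (simp add: indicator_def ennreal_leI assms(3))
  finally show ?thesis .
qed

lemma cum_rate_le:
  assumes "0 \<le> K" "a \<le> b" "\<And>t. t \<in> {a<..b} \<Longrightarrow> \<mu> t \<le> K"
  shows "cum_rate \<mu> a b \<le> ennreal (K * (b - a))"
proof -
  have "cum_rate \<mu> a b \<le> (\<integral>\<^sup>+t\<in>{a<..b}. ennreal K \<partial>lborel)"
    unfolding cum_rate_def
    by (intro nn_integral_mono) (simp add: indicator_def ennreal_leI assms(3))
  also have "\<dots> = ennreal (K * (b - a))"
    using assms by (simp add: nn_integral_cmult_indicator ennreal_mult[symmetric])
  finally show ?thesis .
qed

lemma cum_rate_pos: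
  assumes meas: "set_borel_measurable borel {0<..} \<mu>"
    and pos: "AE t in lborel. 0 \<le> t \<longrightarrow> 0 < \<mu> t" and ab: "0 \<le> a" "a < b"
  shows "0 < cum_rate \<mu> a b"
proof (rule ccontr)
  assume "\<not> 0 < cum_rate \<mu> a b"
  define f where "f t = ennreal (indicator {0<..} t *\<^sub>R \<mu> t) * indicator {a<..b} t" for t
  have "(\<lambda>t. indicator {0<..} t *\<^sub>R \<mu> t) \<in> borel_measurable borel"
    using meas unfolding set_borel_measurable_def .
  then have f[measurable]: "f \<in> borel_measurable lborel" unfolding f_def by measurable
  have "cum_rate \<mu> a b = integral\<^sup>N lborel f"
    unfolding cum_rate_def f_def using ab by (intro nn_integral_cong) (simp add: indicator_def)
  then have "AE t in lborel. f t = 0"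
    using \<open>\<not> 0 < cum_rate \<mu> a b\<close> f by (simp add: nn_integral_0_iff_AE)
  then have "AE t in lborel. t \<notin> {a<..b}"
    using pos by eventually_elim (use ab in \<open>auto simp: f_def split: split_indicator_asm\<close>)
  then have "{a<..b} \<in> null_sets lborel" by (subst AE_iff_null_sets) auto
  then show False using ab by (simp add: null_sets_def)
qed

context poisson_point_process
begin

definition gapless_prob :: "real \<Rightarrow> real \<Rightarrow> real" where
  "gapless_prob l t = prob {\<omega> \<in> space \<Omega>. gapless l (N \<omega>) t}"

lemma tail_ratio_eq:
  "tail_ratio \<Omega> (\<lambda>\<omega>. first_gap l (N \<omega>)) u t = gapless_prob l (t + u) / gapless_prob l t"
proof -
  have "{\<omega> \<in> space \<Omega>. ereal s < first_gap l (N \<omega>)} = {\<omega> \<in> space \<Omega>. gapless l (N \<omega>) s}" for s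
    using less_first_gap_iff_gapless[OF points_pos locally_finite] by auto
  then show ?thesis unfolding tail_ratio_def gapless_prob_def by simp
qed

lemma gapless_prob_antimono: "t \<le> t' \<Longrightarrow> gapless_prob l t' \<le> gapless_prob l t"
  unfolding gapless_prob_def
  by (intro finite_measure_mono gapless_measurable) (auto intro: gapless_mono[OF _ order_refl])

lemma gapless_prob_nonneg: "0 \<le> gapless_prob l t"
  by (simp add: gapless_prob_def)

lemma tail_ratio_nonneg: "0 \<le> tail_ratio \<Omega> D u t"
  by (simp add: tail_ratio_def)

lemma tail_ratio_le_1:
  assumes "0 \<le> u"
  shows "tail_ratio \<Omega> (\<lambda>\<omega>. first_gap l (N \<omega>)) u t \<le> 1"
  unfolding tail_ratio_eq using gapless_prob_antimono[of t "t + u" l] gapless_prob_nonneg[of l t] assms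
  by (auto simp: divide_le_eq_1)

context
  assumes finite_rate: "\<And>t. cum_rate \<mu> 0 t < \<infinity>"
begin

lemma cum_rate_finite:
  assumes "0 \<le> a"
  shows "cum_rate \<mu> a b < \<infinity>"
proof -
  have "cum_rate \<mu> a b \<le> cum_rate \<mu> 0 b"
    unfolding cum_rate_def using assms
    by (intro nn_integral_mono) (simp add: indicator_def)
  then show ?thesis using finite_rate by (rule le_less_trans)
qed

text \<open>
  The tail ratio divides by this probability. Positive rates give each half-step
  \<open>h = l / 2\<close> a positive chance of success. The induction starts at the negative time
  \<open>- l / 2\<close>, up to which gaplessness is vacuous, so that the base case needs no computation.
\<close>
lemma gapless_prob_pos:
  assumes "set_borel_measurable borel {0<..} \<mu>" "AE t in lborel. 0 \<le> t \<longrightarrow> 0 < \<mu> t" "0 < l"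
  shows "0 < gapless_prob l t"
proof -
  define h where "h = l / 2"
  have h: "0 < h" "l = h + h" using assms by (auto simp: h_def)
  have "0 < gapless_prob l (real n * h - h)" for n
  proof (induction n)
    case 0
    have "{\<omega> \<in> space \<Omega>. gapless l (N \<omega>) (- h)} = space \<Omega>" using h by (auto simp: gapless_def)
    then show ?case by (simp add: gapless_prob_def prob_space)
  next
    case (Suc n)
    let ?t = "real n * h - h"
    let ?M = "cum_rate \<mu> (?t + h) (?t + l)"
    have "0 < ?M" using h by (intro cum_rate_pos assms) auto
    moreover have fin: "?M < \<infinity>" using h by (intro cum_rate_finite) auto
    ultimately have "0 < enn2real ?M" by (simp add: enn2real_positive_iff)
    then have "0 < gapless_prob l ?t * (1 - exp (- enn2real ?M))" using Suc by simp
    also have "\<dots> \<le> gapless_prob l (?t + h)"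
      unfolding gapless_prob_def using h fin by (intro prob_gapless_step_ge) auto
    finally show ?case by (simp add: algebra_simps)
  qed
  moreover obtain n where "t + h < real n * h" using reals_Archimedean3[OF h(1)] by blast
  ultimately show ?thesis by (smt (verit) gapless_prob_antimono)
qed

lemma gapless_prob_steps_ge:
  assumes "0 \<le> c" "0 \<le> T" "0 \<le> h"
    and rate: "\<And>s. T \<le> s \<Longrightarrow> ennreal c \<le> cum_rate \<mu> (s + h) (s + l)" and "T \<le> t"
  shows "gapless_prob l t * (1 - exp (- c)) ^ m \<le> gapless_prob l (t + real m * h)"
proof (induction m)
  case (Suc m)
  define s where "s = t + real m * h"
  have "0 \<le> real m * h" using assms by simp
  then have s: "T \<le> s" using \<open>T \<le> t\<close> unfolding s_def by linarith
  have fin: "cum_rate \<mu> (s + h) (s + l) < \<infinity>" using s assms by (intro cum_rate_finite) auto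
  have "c \<le> enn2real (cum_rate \<mu> (s + h) (s + l))"
    using enn2real_mono[OF rate[OF s]] fin assms(1) by simp
  then have "gapless_prob l s * (1 - exp (- c))
      \<le> gapless_prob l s * (1 - exp (- enn2real (cum_rate \<mu> (s + h) (s + l))))"
    by (intro mult_left_mono gapless_prob_nonneg) auto
  also have "\<dots> \<le> gapless_prob l (s + h)"
    unfolding gapless_prob_def using s assms fin by (intro prob_gapless_step_ge) auto
  finally have "gapless_prob l s * (1 - exp (- c)) \<le> gapless_prob l (s + h)" .
  moreover have "gapless_prob l t * (1 - exp (- c)) ^ Suc m \<le> gapless_prob l s * (1 - exp (- c))"
    using mult_right_mono[OF Suc, of "1 - exp (- c)"] assms by (simp add: s_def mult_ac)
  ultimately show ?case by (simp add: s_def algebra_simps)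
qed simp

lemma tail_ratio_ge:
  assumes "set_borel_measurable borel {0<..} \<mu>" "AE t in lborel. 0 \<le> t \<longrightarrow> 0 < \<mu> t" "0 < l"
    and "0 \<le> c" "0 \<le> T" "0 \<le> h" "\<And>s. T \<le> s \<Longrightarrow> ennreal c \<le> cum_rate \<mu> (s + h) (s + l)"
    and "T \<le> t" "u \<le> real m * h"
  shows "(1 - exp (- c)) ^ m \<le> tail_ratio \<Omega> (\<lambda>\<omega>. first_gap l (N \<omega>)) u t"
proof -
  have "gapless_prob l t * (1 - exp (- c)) ^ m \<le> gapless_prob l (t + real m * h)"
    using assms(4-8) by (rule gapless_prob_steps_ge)
  also have "\<dots> \<le> gapless_prob l (t + u)" using assms by (intro gapless_prob_antimono) auto
  finally show ?thesis
    unfolding tail_ratio_eq using gapless_prob_pos[OF assms(1-3), of t]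
    by (simp add: pos_le_divide_eq mult.commute)
qed

lemma tail_ratio_le:
  assumes "0 \<le> t" "0 < l" "l \<le> u" "0 \<le> c" "cum_rate \<mu> (t + l) (t + l + l) \<le> ennreal c"
  shows "tail_ratio \<Omega> (\<lambda>\<omega>. first_gap l (N \<omega>)) u t \<le> 1 - exp (- c)"
proof -
  let ?M = "cum_rate \<mu> (t + l) (t + l + l)"
  have fin: "?M < \<infinity>" using assms by (intro cum_rate_finite) auto
  have "enn2real ?M \<le> c" using assms(4,5) enn2real_leI by blast
  have "gapless_prob l (t + u) \<le> gapless_prob l t * (1 - exp (- enn2real ?M))"
    unfolding gapless_prob_def using assms fin by (intro prob_gapless_step_le) auto
  also have "\<dots> \<le> gapless_prob l t * (1 - exp (- c))"
    using \<open>enn2real ?M \<le> c\<close> by (intro mult_left_mono gapless_prob_nonneg) auto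
  finally have *: "gapless_prob l (t + u) \<le> gapless_prob l t * (1 - exp (- c))" .
  show ?thesis
  proof (cases "gapless_prob l t = 0")
    case True then show ?thesis unfolding tail_ratio_eq using assms by simp
  next
    case False
    then have "0 < gapless_prob l t" using gapless_prob_nonneg[of l t] by simp
    then show ?thesis unfolding tail_ratio_eq using * by (simp add: pos_divide_le_eq mult.commute)
  qed
qed

end

end

theorem proposition4p1:
  fixes \<Omega> :: "'w measure" and \<mu> :: "real \<Rightarrow> real" and N :: "'w \<Rightarrow> real set"
    and l u :: real and D :: "'w \<Rightarrow> ereal"
  assumes "0 < l"
    and "set_borel_measurable borel {0<..} \<mu>"
    and "\<And>t. 0 < t \<Longrightarrow> 0 \<le> \<mu> t"
    and "\<And>t. cum_rate \<mu> 0 t < \<infinity>"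
    and "AE t in lborel. 0 \<le> t \<longrightarrow> 0 < \<mu> t"
    and "poisson_point_process \<Omega> \<mu> N"
    and D_def: "D = (\<lambda>\<omega>. first_gap l (N \<omega>))"
    and "0 < u"
  shows "(filterlim \<mu> at_top at_top \<longrightarrow> (tail_ratio \<Omega> D u \<longlongrightarrow> 1) at_top)
    \<and> ((\<exists>\<epsilon>>0. 0 < Liminf at_top (\<lambda>t. cum_rate \<mu> t (t + l - \<epsilon>)))
        \<longrightarrow> 0 < Liminf at_top (\<lambda>t. ereal (tail_ratio \<Omega> D u t)))
    \<and> (l \<le> u \<longrightarrow>
        ((\<mu> \<longlongrightarrow> 0) at_top \<longrightarrow> (tail_ratio \<Omega> D u \<longlongrightarrow> 0) at_top)
        \<and> (Limsup at_top (\<lambda>t. cum_rate \<mu> t (t + l)) < \<infinity>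
            \<longrightarrow> Limsup at_top (\<lambda>t. ereal (tail_ratio \<Omega> D u t)) < 1))"
proof -
  interpret poisson_point_process \<Omega> \<mu> N by fact
  have lower: "(1 - exp (- c)) ^ m \<le> tail_ratio \<Omega> D u t"
    if "0 \<le> c" "0 \<le> T" "0 \<le> h" "\<And>s. T \<le> s \<Longrightarrow> ennreal c \<le> cum_rate \<mu> (s + h) (s + l)"
      "T \<le> t" "u \<le> real m * h" for c T h t m
    unfolding D_def using that assms by (intro tail_ratio_ge[where T = T and h = h]) auto
  have upper: "tail_ratio \<Omega> D u t \<le> 1 - exp (- c)"
    if "l \<le> u" "0 \<le> t" "0 \<le> c" "cum_rate \<mu> (t + l) (t + l + l) \<le> ennreal c" for t c
    unfolding D_def using that assms by (intro tail_ratio_le) auto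
  have at_most_1: "tail_ratio \<Omega> D u t \<le> 1" for t
    unfolding D_def using \<open>0 < u\<close> by (intro tail_ratio_le_1) auto
  have "(tail_ratio \<Omega> D u \<longlongrightarrow> 1) at_top" if lim: "filterlim \<mu> at_top at_top"
  proof (rule order_tendstoI)
    fix a :: real assume "1 < a"
    then show "\<forall>\<^sub>F t in at_top. tail_ratio \<Omega> D u t < a"
      using at_most_1 by (intro always_eventually allI) (rule le_less_trans)
  next
    fix a :: real assume a: "a < 1"
    obtain m where m: "u \<le> real m * (l / 2)"
      using reals_Archimedean3[of "l / 2"] \<open>0 < l\<close> by (meson half_gt_zero less_imp_le)
    have "((\<lambda>c::real. 1 - exp (- c)) \<longlongrightarrow> 1 - 0) at_top"
      by (intro tendsto_intros filterlim_compose[OF exp_at_bot filterlim_uminus_at_bot_at_top])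
    then have "((\<lambda>c::real. (1 - exp (- c)) ^ m) \<longlongrightarrow> (1 - 0) ^ m) at_top" by (rule tendsto_power)
    then have "\<forall>\<^sub>F c::real in at_top. a < (1 - exp (- c)) ^ m"
      using a by (intro order_tendstoD(1)) auto
    then have "\<forall>\<^sub>F c::real in at_top. 0 \<le> c \<and> a < (1 - exp (- c)) ^ m"
      using eventually_ge_at_top[of "0::real"] by eventually_elim auto
    then obtain c where c: "0 \<le> c" "a < (1 - exp (- c)) ^ m"
      using eventually_happens'[OF trivial_limit_at_top_linorder] by blast
    \<comment> \<open>This rate puts mass at least \<open>c\<close> on every late interval of length \<open>l / 2\<close>.\<close>
    obtain T where T: "\<And>t. T \<le> t \<Longrightarrow> c / (l / 2) \<le> \<mu> t"
      using lim unfolding filterlim_at_top eventually_at_top_linorder by meson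
    have "ennreal c \<le> cum_rate \<mu> (s + l / 2) (s + l)" if "max 0 T \<le> s" for s
      using cum_rate_ge[of "c / (l / 2)" "s + l / 2" "s + l" \<mu>] T that c \<open>0 < l\<close> by (simp add: field_simps)
    then have "(1 - exp (- c)) ^ m \<le> tail_ratio \<Omega> D u t" if "max 0 T \<le> t" for t
      using that c \<open>0 < l\<close> m by (intro lower[of c "max 0 T" "l / 2"]) auto
    then show "\<forall>\<^sub>F t in at_top. a < tail_ratio \<Omega> D u t"
      unfolding eventually_at_top_linorder using c by (meson less_le_trans)
  qed
  moreover have "0 < Liminf at_top (\<lambda>t. ereal (tail_ratio \<Omega> D u t))"
    if eps: "0 < \<epsilon>" and liminf: "0 < Liminf at_top (\<lambda>t. cum_rate \<mu> t (t + l - \<epsilon>))" for \<epsilon>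
  proof -
    obtain d where d: "0 < d" "d < Liminf at_top (\<lambda>t. cum_rate \<mu> t (t + l - \<epsilon>))"
      using dense[OF liminf] by blast
    then have "d < \<infinity>" by (auto intro: less_le_trans)
    then obtain c where c: "0 < c" "d = ennreal c" using d(1) by (cases d) auto
    obtain T where T: "\<And>t. T \<le> t \<Longrightarrow> ennreal c < cum_rate \<mu> t (t + l - \<epsilon>)"
      using less_LiminfD[OF d(2)] c unfolding eventually_at_top_linorder by blast
    obtain m where m: "u \<le> real m * \<epsilon>" using reals_Archimedean3[OF eps] by (meson less_imp_le)
    \<comment> \<open>At \<open>t = s + \<epsilon>\<close> the interval \<open>(t, t + l - \<epsilon>]\<close> is the one of a step of length \<open>\<epsilon>\<close> from \<open>s\<close>.\<close>
    have "ennreal c \<le> cum_rate \<mu> (s + \<epsilon>) (s + l)" if "max 0 T \<le> s" for s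
      using T[of "s + \<epsilon>"] that eps by (simp add: less_imp_le)
    then have "(1 - exp (- c)) ^ m \<le> tail_ratio \<Omega> D u t" if "max 0 T \<le> t" for t
      using that c eps m by (intro lower[of c "max 0 T" \<epsilon>]) auto
    then have "ereal ((1 - exp (- c)) ^ m) \<le> Liminf at_top (\<lambda>t. ereal (tail_ratio \<Omega> D u t))"
      by (intro Liminf_bounded eventually_at_top_linorderI[of "max 0 T"]) auto
    moreover have "0 < ereal ((1 - exp (- c)) ^ m)" using c by simp
    ultimately show ?thesis by (rule less_le_trans[rotated])
  qed
  moreover have "(tail_ratio \<Omega> D u \<longlongrightarrow> 0) at_top" if lu: "l \<le> u" and lim: "(\<mu> \<longlongrightarrow> 0) at_top"
  proof (rule order_tendstoI)
    fix a :: real assume "a < 0"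
    then show "\<forall>\<^sub>F t in at_top. a < tail_ratio \<Omega> D u t"
      using tail_ratio_nonneg by (intro always_eventually allI) (rule less_le_trans)
  next
    fix a :: real assume a: "0 < a"
    have "((\<lambda>c::real. 1 - exp (- c)) \<longlongrightarrow> 1 - exp (- 0)) (at_right 0)" by (intro tendsto_intros)
    then have "\<forall>\<^sub>F c::real in at_right 0. 1 - exp (- c) < a"
      using a by (intro order_tendstoD(2)) auto
    then have "\<forall>\<^sub>F c::real in at_right 0. 0 < c \<and> 1 - exp (- c) < a"
      using eventually_at_right_less by eventually_elim auto
    then obtain c where c: "0 < c" "1 - exp (- c) < a"
      using eventually_happens'[OF trivial_limit_at_right_real] by blast
    have "\<forall>\<^sub>F t in at_top. \<mu> t < c / l" using lim c \<open>0 < l\<close> by (intro order_tendstoD(2)) auto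
    then obtain T where T: "\<And>t. T \<le> t \<Longrightarrow> \<mu> t < c / l"
      unfolding eventually_at_top_linorder by blast
    have "tail_ratio \<Omega> D u t \<le> 1 - exp (- c)" if t: "max 0 T \<le> t" for t
    proof (rule upper)
      have "cum_rate \<mu> (t + l) (t + l + l) \<le> ennreal (c / l * (t + l + l - (t + l)))"
        using t c \<open>0 < l\<close> by (intro cum_rate_le less_imp_le[OF T]) auto
      then show "cum_rate \<mu> (t + l) (t + l + l) \<le> ennreal c" using \<open>0 < l\<close> by simp
    qed (use t c lu in auto)
    then show "\<forall>\<^sub>F t in at_top. tail_ratio \<Omega> D u t < a"
      unfolding eventually_at_top_linorder using c by (meson le_less_trans)
  qed
  moreover have "Limsup at_top (\<lambda>t. ereal (tail_ratio \<Omega> D u t)) < 1"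
    if lu: "l \<le> u" and limsup: "Limsup at_top (\<lambda>t. cum_rate \<mu> t (t + l)) < \<infinity>"
  proof -
    obtain d where d: "Limsup at_top (\<lambda>t. cum_rate \<mu> t (t + l)) < d" "d < \<infinity>"
      using dense[OF limsup] by blast
    obtain c where c: "0 \<le> c" "d = ennreal c" using d(2) by (cases d) auto
    obtain T where T: "\<And>t. T \<le> t \<Longrightarrow> cum_rate \<mu> t (t + l) < ennreal c"
      using Limsup_lessD[OF d(1)] c unfolding eventually_at_top_linorder by blast
    have "tail_ratio \<Omega> D u t \<le> 1 - exp (- c)" if "max 0 T \<le> t" for t
      using that c lu \<open>0 < l\<close> by (intro upper less_imp_le[OF T]) auto
    then have "Limsup at_top (\<lambda>t. ereal (tail_ratio \<Omega> D u t)) \<le> ereal (1 - exp (- c))"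
      by (intro Limsup_bounded eventually_at_top_linorderI[of "max 0 T"]) auto
    also have "\<dots> < 1" by simp
    finally show ?thesis .
  qed
  ultimately show ?thesis by blast
qed

end
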